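(* Let $\mathcal{X}$ be an $n$-dimensional state space with global coordinates in $\mathbb{R}^n$, let $\mathcal{U},\mathcal{W}$ be nonempty sets, let $f:\mathcal{X}\times\mathcal{U}\times\mathcal{W}\to\mathcal{X}$ be a map, let $N\ge 0$ be an integer, and let $X=(X_0,\dots,X_N)$ be a sequence of subsets of $\mathcal{X}$ (the target tube). Let $\mathcal{G}$ be an $r$-dimensional Lie group, $r\le n$, and let $h_\alpha=(\phi_\alpha,\chi_\alpha,\psi_\alpha)$, $\alpha\in\mathcal{G}$, be a transformation group on $\mathcal{X}\times\mathcal{U}\times\mathcal{W}$, with each $\phi_\alpha$ a diffeomorphism of $\mathcal{X}$, such that the backward reachability problem $(f,X)$ is invariant under $h$. Let $\mathcal{C}$ be a coordinate cross section to the orbits with (global) moving frame $\gamma:\mathcal{X}\to\mathcal{G}$, let $\rho:\mathcal{X}\to\mathbb{R}^{n-r}$ be the associated invariants, and let $\bar\rho=\rho|_{\mathcal{C}}$, which is injective, with inverse $\bar\rho^{-1}:\rho(\mathcal{C})\to\mathcal{C}$. Let $J_k:\mathcal{X}\to\mathbb{R}$ be the value functions and $\bar X_k$ the effective target sets of $(f,X)$, and define the reduced value functions $\bar J_k=J_k\circ\bar\rho^{-1}$ on $\rho(\mathcal{C})$, $k=0,\dots,N$. Then the reduced value functions satisfy the following recursion for all $\bar x\in\rho(\mathcal{C})$: \[ \bar J_N(\bar x)=g_N(\bar\rho^{-1}(\bar x)), \] \[ \bar J_k(\bar x)=\min_{u\in\mathcal{U}}\max_{w\in\mathcal{W}}\Big[g_k(\bar\rho^{-1}(\bar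 x))+\bar J_{k+1}\big(\rho(f(\bar\rho^{-1}(\bar x),u,w))\big)\Big],\qquad k=0,\dots,N-1, \] and the effective target sets are recovered from them by $\bar X_k=\{x\in\mathcal{X}:\bar J_k(\rho(x))=0\}$ for $k=0,\dots,N$.
   Context: The system is $x_{k+1}=f(x_k,u_k,w_k)$ with state $x_k\in\mathcal{X}$, control $u_k\in\mathcal{U}$ and disturbance $w_k\in\mathcal{W}$. Value functions: $g_k(x)=0$ if $x\in X_k$ and $g_k(x)=1$ if $x\notin X_k$; $J_N(x)=g_N(x)$ and $J_k(x)=\min_{u\in\mathcal{U}}\max_{w\in\mathcal{W}}[g_k(x)+J_{k+1}(f(x,u,w))]$ for $k=N-1,\dots,0$. (These functions take values in $\{0,1,\dots,N+1\}$, so the minima and maxima are attained.) Effective target sets: $\bar X_k=\{x\in\mathcal{X}:J_k(x)=0\}$. Equivalently, $\bar X_k$ is the set of states $x_k$ for which there are feedback maps $\mu_t:\mathcal{X}\to\mathcal{U}$, $t=k,\dots,N-1$, such that for all disturbances $w_k,\dots,w_{N-1}\in\mathcal{W}$ the trajectory $x_{t+1}=f(x_t,\mu_t(x_t),w_t)$ satisfies $x_t\in X_t$ for all $t=k,\dots,N$. Transformation group: a family of tuples $h_\alpha=(\phi_\alpha,\chi_\alpha,\psi_\alpha)$ indexed by $\alpha\in\mathcal{G}$, where $\phi_\alpha:\mathcal{X}\to\mathcal{X}$, $\chi_\alpha:\mathcal{U}\to\mathcal{U}$, $\psi_\alpha:\mathcal{W}\to\mathcal{W}$ are bijections, such that $\phi_e,\chi_e,\psi_e$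 are identity maps for the identity $e$ of $\mathcal{G}$, and $\phi_{a*b}=\phi_a\circ\phi_b$, $\chi_{a*b}=\chi_a\circ\chi_b$, $\psi_{a*b}=\psi_a\circ\psi_b$ for all $a,b\in\mathcal{G}$, where $*$ is the group operation. Invariance: $(f,X)$ is invariant under $h$ if for all $\alpha\in\mathcal{G}$: (i) $\phi_\alpha(x)\in X_k$ for all $x\in X_k$ and $k=0,\dots,N$; and (ii) $\phi_\alpha^{-1}\big(f(\phi_\alpha(x),\chi_\alpha(u),\psi_\alpha(w))\big)=f(x,u,w)$ for all $x\in\mathcal{X}$, $u\in\mathcal{U}$, $w\in\mathcal{W}$. Moving frame: the $n$ coordinate components of $\phi_\alpha$ are split as $\phi_\alpha=(\phi_\alpha^a,\phi_\alpha^b)$ with $r$ and $n-r$ components respectively (the same splitting of coordinates for all $\alpha$), so that $\phi_\alpha^a(x)$ is invertible with respect to $\alpha$. For a fixed $c$ in the range of $\phi^a$, the coordinate cross section is $\mathcal{C}=\{x\in\mathcal{X}:\phi_e^a(x)=c\}$. It is assumed that for every $x\in\mathcal{X}$ there is a unique $\alpha\in\mathcal{G}$ with $\phi_\alpha(x)\in\mathcal{C}$; this $\alpha$ is denoted $\gamma(x)$, and $\gamma:\mathcal{X}\to\mathcal{G}$ is the moving frame. Equivalently, $\gamma(x)$ is the solution of the normalization equations $\phi^a_{\gamma(x)}(x)=c$. The invariants are $\rho(x)=\phi^b_{\gamma(x)}(x)\in\mathbb{R}^{n-r}$. *)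

theory Defs
  imports "HOL-Analysis.Analysis" "HOL-Algebra.Group" "HOL-Combinatorics.Permutations"
begin

section \<open>Smooth maps and Lie groups\<close>

text \<open>
  Coordinate vectors in \<open>\<real>\<^sup>n\<close> are the points of \<^term>\<open>Euclidean_space n\<close>, i.e. functions
  \<open>nat \<Rightarrow> real\<close> vanishing from index \<open>n\<close> on.  The dimensions are thus natural numbers, and
  \<open>\<real>\<^sup>0\<close> is included.
\<close>

text \<open>
  \<open>C\<^sup>k\<close> functions on an open subset of \<open>\<real>\<^sup>n\<close>: all iterated partial derivatives up to order \<open>k\<close>
  exist and are continuous.  Only the values of the function on \<open>S\<close> matter when \<open>S\<close> is open in
  \<^term>\<open>Euclidean_space n\<close>.
\<close>

primrec Ck_on :: "nat \<Rightarrow> nat \<Rightarrow> (nat \<Rightarrow> real) set \<Rightarrow> ((nat \<Rightarrow> real) \<Rightarrow> real) \<Rightarrow> bool" where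
  "Ck_on n 0 S F \<longleftrightarrow> continuous_map (subtopology (Euclidean_space n) S) euclideanreal F"
| "Ck_on n (Suc k) S F \<longleftrightarrow>
     continuous_map (subtopology (Euclidean_space n) S) euclideanreal F \<and>
     (\<forall>i<n. \<exists>F'. (\<forall>x\<in>S. ((\<lambda>t. F (x(i := t))) has_real_derivative F' x) (at (x i))) \<and>
                 Ck_on n k S F')"

definition smooth_on ::
  "nat \<Rightarrow> nat \<Rightarrow> (nat \<Rightarrow> real) set \<Rightarrow> ((nat \<Rightarrow> real) \<Rightarrow> nat \<Rightarrow> real) \<Rightarrow> bool" where
  "smooth_on n m S F \<longleftrightarrow>
     F ` S \<subseteq> topspace (Euclidean_space m) \<and> (\<forall>j<m. \<forall>k. Ck_on n k S (\<lambda>x. F x j))"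

definition diffeomorphism_on ::
  "nat \<Rightarrow> (nat \<Rightarrow> real) set \<Rightarrow> ((nat \<Rightarrow> real) \<Rightarrow> nat \<Rightarrow> real) \<Rightarrow> bool" where
  "diffeomorphism_on n S F \<longleftrightarrow>
     bij_betw F S S \<and> smooth_on n n S F \<and> smooth_on n n S (inv_into S F)"

type_synonym 'a chart = "'a set \<times> ('a \<Rightarrow> nat \<Rightarrow> real)"

definition smooth_atlas :: "nat \<Rightarrow> 'a topology \<Rightarrow> 'a chart set \<Rightarrow> bool" where
  "smooth_atlas n T A \<longleftrightarrow>
     (\<forall>(D, \<kappa>)\<in>A. openin T D \<and>
        (\<exists>V. openin (Euclidean_space n) V \<and>
             homeomorphic_map (subtopology T D) (subtopology (Euclidean_space n) V) \<kappa>)) \<and>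
     (\<Union>(D, \<kappa>)\<in>A. D) = topspace T \<and>
     (\<forall>(D, \<kappa>)\<in>A. \<forall>(E, \<eta>)\<in>A. smooth_on n n (\<kappa> ` (D \<inter> E)) (\<eta> \<circ> inv_into D \<kappa>))"

definition smooth_manifold :: "nat \<Rightarrow> 'a topology \<Rightarrow> 'a chart set \<Rightarrow> bool" where
  "smooth_manifold n T A \<longleftrightarrow> Hausdorff_space T \<and> second_countable T \<and> smooth_atlas n T A"

definition smooth_map ::
  "nat \<Rightarrow> 'a topology \<Rightarrow> 'a chart set \<Rightarrow> nat \<Rightarrow> 'b topology \<Rightarrow> 'b chart set \<Rightarrow> ('a \<Rightarrow> 'b) \<Rightarrow> bool" where
  "smooth_map n T A m T' B F \<longleftrightarrow>
     continuous_map T T' F \<and>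
     (\<forall>(D, \<kappa>)\<in>A. \<forall>(E, \<eta>)\<in>B. smooth_on n m (\<kappa> ` (D \<inter> F -` E)) (\<eta> \<circ> F \<circ> inv_into D \<kappa>))"

text \<open>Charts of a product manifold; the first factor has dimension \<open>n\<close>.\<close>

definition product_atlas :: "nat \<Rightarrow> 'a chart set \<Rightarrow> 'b chart set \<Rightarrow> ('a \<times> 'b) chart set" where
  "product_atlas n A B =
     {(D \<times> E, \<lambda>(a, b) i. if i < n then \<kappa> a i else \<eta> b (i - n)) | D \<kappa> E \<eta>. (D, \<kappa>) \<in> A \<and> (E, \<eta>) \<in> B}"

definition lie_group ::
  "nat \<Rightarrow> ('g, 'z) monoid_scheme \<Rightarrow> 'g topology \<Rightarrow> 'g chart set \<Rightarrow> bool" where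
  "lie_group r G T A \<longleftrightarrow>
     group G \<and> topspace T = carrier G \<and> smooth_manifold r T A \<and>
     smooth_map (r + r) (prod_topology T T) (product_atlas r A A) r T A (\<lambda>(a, b). a \<otimes>\<^bsub>G\<^esub> b) \<and>
     smooth_map r T A r T A (\<lambda>a. inv\<^bsub>G\<^esub> a)"

section \<open>Backward reachability\<close>

definition stage_cost :: "(nat \<Rightarrow> 'x set) \<Rightarrow> nat \<Rightarrow> 'x \<Rightarrow> real" where
  "stage_cost X k x = (if x \<in> X k then 0 else 1)"

text \<open>
  The backward recursion, started at \<open>k = N\<close>; the value at \<open>k > N\<close> is irrelevant.  Although \<open>U\<close> and
  \<open>W\<close> may be infinite, \<open>Min\<close> and \<open>Max\<close> are only applied to finite nonempty sets of values when
  \<open>U\<close> and \<open>W\<close> are nonempty: see the lemmas below.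
\<close>

function value_fun ::
  "('x \<Rightarrow> 'u \<Rightarrow> 'w \<Rightarrow> 'x) \<Rightarrow> 'u set \<Rightarrow> 'w set \<Rightarrow> (nat \<Rightarrow> 'x set) \<Rightarrow> nat \<Rightarrow> nat \<Rightarrow> 'x \<Rightarrow> real" where
  "value_fun f U W X N k x =
     (if k < N
      then (MIN u\<in>U. MAX w\<in>W. stage_cost X k x + value_fun f U W X N (Suc k) (f x u w))
      else stage_cost X N x)"
  by pat_completeness auto
termination
  by (relation "Wellfounded.measure (\<lambda>(f, U, W, X, N, k, x). N - k)") auto

declare value_fun.simps [simp del]

lemma value_fun_range:
  assumes "U \<noteq> {}" "W \<noteq> {}" "k \<le> N"
  shows "value_fun f U W X N k x \<in> real ` {..Suc N - k}"
  using assms(3)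
proof (induction "N - k" arbitrary: k x)
  case 0
  then show ?case by (auto simp: value_fun.simps stage_cost_def image_iff)
next
  case (Suc d)
  let ?R = "real ` {..Suc N - k}"
  let ?t = "\<lambda>u w. stage_cost X k x + value_fun f U W X N (Suc k) (f x u w)"
  from Suc have k: "k < N" by simp
  have t: "?t u w \<in> ?R" for u w
  proof -
    have "value_fun f U W X N (Suc k) (f x u w) \<in> real ` {..Suc N - Suc k}"
      using Suc.hyps(2) k by (intro Suc.hyps(1)) simp_all
    then obtain j where j: "j \<le> Suc N - Suc k" "value_fun f U W X N (Suc k) (f x u w) = real j"
      by auto
    have "?t u w = real (if x \<in> X k then j else Suc j)"
      using j by (simp add: stage_cost_def)
    moreover have "(if x \<in> X k then j else Suc j) \<in> {..Suc N - k}"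
      using j k by auto
    ultimately show ?thesis by blast
  qed
  have fin: "finite ?R" by simp
  have m: "(MAX w\<in>W. ?t u w) \<in> ?R" for u
  proof -
    have sub: "?t u ` W \<subseteq> ?R" using t by blast
    have "(MAX w\<in>W. ?t u w) \<in> ?t u ` W"
      using assms(2) finite_subset[OF sub fin] by (intro Max_in) auto
    then show ?thesis using sub by blast
  qed
  have sub: "(\<lambda>u. MAX w\<in>W. ?t u w) ` U \<subseteq> ?R" using m by blast
  have "(MIN u\<in>U. MAX w\<in>W. ?t u w) \<in> (\<lambda>u. MAX w\<in>W. ?t u w) ` U"
    using assms(1) finite_subset[OF sub fin] by (intro Min_in) auto
  then show ?case using sub k by (subst value_fun.simps) auto
qed

lemma finite_value_fun_max_set:
  assumes "U \<noteq> {}" "W \<noteq> {}" "k < N"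
  shows "finite ((\<lambda>w. stage_cost X k x + value_fun f U W X N (Suc k) (f x u w)) ` W)"
proof -
  have "(\<lambda>w. stage_cost X k x + value_fun f U W X N (Suc k) (f x u w)) ` W
        \<subseteq> (\<lambda>v. stage_cost X k x + v) ` real ` {..Suc N - Suc k}"
    using value_fun_range[OF assms(1,2), of "Suc k" N] assms(3) by fastforce
  then show ?thesis by (rule finite_subset) simp
qed

lemma finite_value_fun_min_set:
  assumes "U \<noteq> {}" "W \<noteq> {}" "k < N"
  shows "finite ((\<lambda>u. MAX w\<in>W. stage_cost X k x + value_fun f U W X N (Suc k) (f x u w)) ` U)"
proof -
  let ?t = "\<lambda>u w. stage_cost X k x + value_fun f U W X N (Suc k) (f x u w)"
  have "(MAX w\<in>W. ?t u w) \<in> ?t u ` W" for u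
    by (rule Max_in) (use assms(2) in \<open>simp_all add: finite_value_fun_max_set[OF assms]\<close>)
  moreover have "?t u ` W \<subseteq> (\<lambda>v. stage_cost X k x + v) ` real ` {..Suc N - Suc k}" for u
    using value_fun_range[OF assms(1,2), of "Suc k" N] assms(3) by fastforce
  ultimately have "(\<lambda>u. MAX w\<in>W. ?t u w) ` U
        \<subseteq> (\<lambda>v. stage_cost X k x + v) ` real ` {..Suc N - Suc k}"
    by blast
  then show ?thesis by (rule finite_subset) simp
qed

definition effective_target ::
  "'x set \<Rightarrow> ('x \<Rightarrow> 'u \<Rightarrow> 'w \<Rightarrow> 'x) \<Rightarrow> 'u set \<Rightarrow> 'w set \<Rightarrow> (nat \<Rightarrow> 'x set) \<Rightarrow> nat \<Rightarrow> nat \<Rightarrow> 'x set" where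
  "effective_target \<X> f U W X N k = {x \<in> \<X>. value_fun f U W X N k x = 0}"

section \<open>Symmetries and moving frames\<close>

definition transformation_group ::
  "('g, 'z) monoid_scheme \<Rightarrow> 'x set \<Rightarrow> 'u set \<Rightarrow> 'w set \<Rightarrow>
   ('g \<Rightarrow> 'x \<Rightarrow> 'x) \<Rightarrow> ('g \<Rightarrow> 'u \<Rightarrow> 'u) \<Rightarrow> ('g \<Rightarrow> 'w \<Rightarrow> 'w) \<Rightarrow> bool" where
  "transformation_group G \<X> U W \<phi> chi \<psi> \<longleftrightarrow>
     (\<forall>\<alpha>\<in>carrier G. bij_betw (\<phi> \<alpha>) \<X> \<X> \<and> bij_betw (chi \<alpha>) U U \<and> bij_betw (\<psi> \<alpha>) W W) \<and>
     (\<forall>x\<in>\<X>. \<phi> \<one>\<^bsub>G\<^esub> x = x) \<and> (\<forall>u\<in>U. chi \<one>\<^bsub>G\<^esub> u = u) \<and> (\<forall>w\<in>W. \<psi> \<one>\<^bsub>G\<^esub> w = w) \<and>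
     (\<forall>a\<in>carrier G. \<forall>b\<in>carrier G.
        (\<forall>x\<in>\<X>. \<phi> (a \<otimes>\<^bsub>G\<^esub> b) x = \<phi> a (\<phi> b x)) \<and>
        (\<forall>u\<in>U. chi (a \<otimes>\<^bsub>G\<^esub> b) u = chi a (chi b u)) \<and>
        (\<forall>w\<in>W. \<psi> (a \<otimes>\<^bsub>G\<^esub> b) w = \<psi> a (\<psi> b w)))"

definition invariant_problem ::
  "('g, 'z) monoid_scheme \<Rightarrow> 'x set \<Rightarrow> 'u set \<Rightarrow> 'w set \<Rightarrow>
   ('g \<Rightarrow> 'x \<Rightarrow> 'x) \<Rightarrow> ('g \<Rightarrow> 'u \<Rightarrow> 'u) \<Rightarrow> ('g \<Rightarrow> 'w \<Rightarrow> 'w) \<Rightarrow>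
   ('x \<Rightarrow> 'u \<Rightarrow> 'w \<Rightarrow> 'x) \<Rightarrow> (nat \<Rightarrow> 'x set) \<Rightarrow> nat \<Rightarrow> bool" where
  "invariant_problem G \<X> U W \<phi> chi \<psi> f X N \<longleftrightarrow>
     (\<forall>\<alpha>\<in>carrier G.
        (\<forall>k\<le>N. \<forall>x\<in>X k. \<phi> \<alpha> x \<in> X k) \<and>
        (\<forall>x\<in>\<X>. \<forall>u\<in>U. \<forall>w\<in>W.
           inv_into \<X> (\<phi> \<alpha>) (f (\<phi> \<alpha> x) (chi \<alpha> u) (\<psi> \<alpha> w)) = f x u w))"

text \<open>
  A splitting of the \<open>n\<close> coordinates into \<open>r\<close> and \<open>n - r\<close> of them is given by a permutation \<open>\<sigma>\<close> of
  the coordinate indices: the first block consists of the coordinates \<open>\<sigma> 0, \<dots>, \<sigma> (r - 1)\<close>, the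
  second of \<open>\<sigma> r, \<dots>, \<sigma> (n - 1)\<close>.
\<close>

definition comp_a :: "nat \<Rightarrow> (nat \<Rightarrow> nat) \<Rightarrow> (nat \<Rightarrow> real) \<Rightarrow> nat \<Rightarrow> real" where
  "comp_a r \<sigma> x = (\<lambda>j. if j < r then x (\<sigma> j) else 0)"

definition comp_b :: "nat \<Rightarrow> nat \<Rightarrow> (nat \<Rightarrow> nat) \<Rightarrow> (nat \<Rightarrow> real) \<Rightarrow> nat \<Rightarrow> real" where
  "comp_b n r \<sigma> x = (\<lambda>j. if j < n - r then x (\<sigma> (r + j)) else 0)"

definition cross_section ::
  "('g, 'z) monoid_scheme \<Rightarrow> (nat \<Rightarrow> real) set \<Rightarrow> ('g \<Rightarrow> (nat \<Rightarrow> real) \<Rightarrow> nat \<Rightarrow> real) \<Rightarrow>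
   nat \<Rightarrow> (nat \<Rightarrow> nat) \<Rightarrow> (nat \<Rightarrow> real) \<Rightarrow> (nat \<Rightarrow> real) set" where
  "cross_section G \<X> \<phi> r \<sigma> c = {x \<in> \<X>. comp_a r \<sigma> (\<phi> \<one>\<^bsub>G\<^esub> x) = c}"

definition moving_frame ::
  "('g, 'z) monoid_scheme \<Rightarrow> 'x set \<Rightarrow> ('g \<Rightarrow> 'x \<Rightarrow> 'x) \<Rightarrow> 'x set \<Rightarrow> ('x \<Rightarrow> 'g) \<Rightarrow> bool" where
  "moving_frame G \<X> \<phi> C \<gamma> \<longleftrightarrow>
     (\<forall>x\<in>\<X>. \<gamma> x \<in> carrier G \<and> \<phi> (\<gamma> x) x \<in> C \<and> (\<forall>\<alpha>\<in>carrier G. \<phi> \<alpha> x \<in> C \<longrightarrow> \<alpha> = \<gamma> x))"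

definition frame_invariants ::
  "nat \<Rightarrow> nat \<Rightarrow> (nat \<Rightarrow> nat) \<Rightarrow> ('g \<Rightarrow> (nat \<Rightarrow> real) \<Rightarrow> nat \<Rightarrow> real) \<Rightarrow>
   ((nat \<Rightarrow> real) \<Rightarrow> 'g) \<Rightarrow> (nat \<Rightarrow> real) \<Rightarrow> nat \<Rightarrow> real" where
  "frame_invariants n r \<sigma> \<phi> \<gamma> x = comp_b n r \<sigma> (\<phi> (\<gamma> x) x)"

end

theory Submission
  imports Defs
begin

text \<open>
  By backward induction the value functions are constant on the orbits of \<open>\<phi>\<close>: equivariance of the
  dynamics lets the bijections of the control and disturbance sets be absorbed into the minimum and
  the maximum. On the cross section the moving frame is the identity, so a point there is determined
  by its \<open>a\<close>-coordinates \<open>c\<close> together with its \<open>b\<close>-coordinates, which are its invariants. Hence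
  \<open>\<rho>inv (\<rho> x) = \<phi> (\<gamma> x) x\<close> lies on the orbit of \<open>x\<close>, and \<open>Jbar k (\<rho> x) = J k x\<close>.
\<close>

text \<open>Invariance only says that each \<open>\<phi> \<beta>\<close> maps \<open>X k\<close>
  into itself. Using it for \<open>\<alpha>\<close> and for its group inverse, which undoes
  \<open>\<phi> \<alpha>\<close>, makes membership in \<open>X k\<close> an equivalence.\<close>

lemma stage_cost_invariant:
  assumes "group G" "transformation_group G \<X> U W \<phi> chi \<psi>"
    and "invariant_problem G \<X> U W \<phi> chi \<psi> f X N"
    and "\<alpha> \<in> carrier G" "x \<in> \<X>" "k \<le> N"
  shows "stage_cost X k (\<phi> \<alpha> x) = stage_cost X k x"
proof -
  interpret group G by fact
  have inv: "inv\<^bsub>G\<^esub> \<alpha> \<in> carrier G" using assms(4) by simp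
  have "\<phi> (inv\<^bsub>G\<^esub> \<alpha>) (\<phi> \<alpha> x) = \<phi> (inv\<^bsub>G\<^esub> \<alpha> \<otimes>\<^bsub>G\<^esub> \<alpha>) x"
    using assms(2,4,5) inv unfolding transformation_group_def by metis
  also have "\<dots> = x"
    using assms(2,4,5) by (simp add: transformation_group_def)
  finally have "\<phi> (inv\<^bsub>G\<^esub> \<alpha>) (\<phi> \<alpha> x) = x" .
  moreover have "\<phi> \<beta> y \<in> X k" if "\<beta> \<in> carrier G" "y \<in> X k" for \<beta> y
    using assms(3,6) that by (simp add: invariant_problem_def)
  ultimately have "\<phi> \<alpha> x \<in> X k \<longleftrightarrow> x \<in> X k"
    using inv assms(4) by metis
  then show ?thesis by (simp add: stage_cost_def)
qed

text \<open>The term \<open>inv_into\<close> is a genuine right inverse only on the image of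
  \<open>\<phi> \<alpha>\<close>. That image is all of \<open>\<X>\<close>, where the dynamics stay,
  so \<open>\<phi> \<alpha>\<close> may be applied to both sides of the invariance equation.\<close>

lemma dynamics_equivariant:
  assumes "transformation_group G \<X> U W \<phi> chi \<psi>" "invariant_problem G \<X> U W \<phi> chi \<psi> f X N"
    and dynamics: "\<And>x u w. x \<in> \<X> \<Longrightarrow> u \<in> U \<Longrightarrow> w \<in> W \<Longrightarrow> f x u w \<in> \<X>"
    and "\<alpha> \<in> carrier G" "x \<in> \<X>" "u \<in> U" "w \<in> W"
  shows "f (\<phi> \<alpha> x) (chi \<alpha> u) (\<psi> \<alpha> w) = \<phi> \<alpha> (f x u w)"
proof -
  have bij: "bij_betw (\<phi> \<alpha>) \<X> \<X>" "bij_betw (chi \<alpha>) U U" "bij_betw (\<psi> \<alpha>) W W"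
    using assms by (auto simp: transformation_group_def)
  then have "f (\<phi> \<alpha> x) (chi \<alpha> u) (\<psi> \<alpha> w) \<in> \<phi> \<alpha> ` \<X>"
    using assms by (auto simp: bij_betw_imp_surj_on intro!: dynamics dest: bij_betwE)
  moreover have "inv_into \<X> (\<phi> \<alpha>) (f (\<phi> \<alpha> x) (chi \<alpha> u) (\<psi> \<alpha> w)) = f x u w"
    using assms by (simp add: invariant_problem_def)
  ultimately show ?thesis by (metis f_inv_into_f)
qed

lemma value_fun_invariant:
  assumes "group G" "transformation_group G \<X> U W \<phi> chi \<psi>"
    and "invariant_problem G \<X> U W \<phi> chi \<psi> f X N"
    and dynamics: "\<And>x u w. x \<in> \<X> \<Longrightarrow> u \<in> U \<Longrightarrow> w \<in> W \<Longrightarrow> f x u w \<in> \<X>"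
    and "\<alpha> \<in> carrier G" "k \<le> N" "x \<in> \<X>"
  shows "value_fun f U W X N k (\<phi> \<alpha> x) = value_fun f U W X N k x"
  using assms(6,7)
proof (induction k arbitrary: x rule: inc_induct)
  case base
  then show ?case
    using stage_cost_invariant[OF assms(1-3,5)] by (simp add: value_fun.simps)
next
  case (step k)
  let ?t = "\<lambda>x u w. stage_cost X k x + value_fun f U W X N (Suc k) (f x u w)"
  have U: "chi \<alpha> ` U = U" and W: "\<psi> \<alpha> ` W = W"
    using assms(2,5) by (auto simp: transformation_group_def bij_betw_def)
  \<comment> \<open>Equivariance turns the successor state into
    \<open>\<phi> \<alpha> (f x u w)\<close>, to which the induction hypothesis applies at
    \<open>Suc k\<close>; hence the state is kept arbitrary.\<close>
  have t: "?t (\<phi> \<alpha> x) (chi \<alpha> u) (\<psi> \<alpha> w) = ?t x u w" if "u \<in> U" "w \<in> W" for u w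
    using step that dynamics assms(5)
    by (simp add: dynamics_equivariant[OF assms(2,3) dynamics]
        stage_cost_invariant[OF assms(1-3)])
  \<comment> \<open>\<open>Min\<close> and \<open>Max\<close> depend only on the sets of values, so
    reindexing along the surjections \<open>chi \<alpha>\<close> and \<open>\<psi> \<alpha>\<close>
    suffices.\<close>
  have "(MIN u\<in>U. MAX w\<in>W. ?t (\<phi> \<alpha> x) u w)
      = (MIN u\<in>chi \<alpha> ` U. MAX w\<in>\<psi> \<alpha> ` W. ?t (\<phi> \<alpha> x) u w)"
    by (simp only: U W)
  also have "\<dots> = (MIN u\<in>U. MAX w\<in>W. ?t (\<phi> \<alpha> x) (chi \<alpha> u) (\<psi> \<alpha> w))"
    by (simp only: image_image)
  also have "\<dots> = (MIN u\<in>U. MAX w\<in>W. ?t x u w)"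
    using t by (simp cong: image_cong)
  finally show ?case
    using step.hyps by (simp add: value_fun.simps[of _ _ _ _ _ k])
qed

text \<open>The unit already carries \<open>x\<close> into \<open>C\<close>, so uniqueness of the
  frame forces \<open>\<gamma> x\<close> to be the unit.\<close>

lemma moving_frame_on_section:
  assumes "group G" "transformation_group G \<X> U W \<phi> chi \<psi>" "moving_frame G \<X> \<phi> C \<gamma>"
    and "x \<in> C" "x \<in> \<X>"
  shows "\<phi> (\<gamma> x) x = x"
proof -
  have "\<phi> \<one>\<^bsub>G\<^esub> x = x" using assms by (simp add: transformation_group_def)
  moreover have "\<one>\<^bsub>G\<^esub> \<in> carrier G"
    using assms(1) by (simp add: group.is_monoid)
  ultimately show ?thesis
    using assms unfolding moving_frame_def by metis
qed

lemma comp_a_comp_b_eqD: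
  assumes "\<sigma> permutes {..<n}" and "r \<le> n"
    and "x \<in> topspace (Euclidean_space n)" "y \<in> topspace (Euclidean_space n)"
    and a: "comp_a r \<sigma> x = comp_a r \<sigma> y" and b: "comp_b n r \<sigma> x = comp_b n r \<sigma> y"
  shows "x = y"
proof
  fix i
  show "x i = y i"
  proof (cases "i < n")
    case True
    then obtain j where j: "j < n" "i = \<sigma> j"
      using permutes_image[OF assms(1)] by (metis imageE lessThan_iff)
    show ?thesis
    proof (cases "j < r")
      case True
      then show ?thesis using fun_cong[OF a, of j] j by (simp add: comp_a_def)
    next
      case False
      \<comment> \<open>The second block is indexed from 0, so coordinate \<open>\<sigma> j\<close>
        with \<open>r \<le> j\<close> sits at position \<open>j - r\<close>.\<close>
      then have "j - r < n - r" "r + (j - r) = j" using j by auto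
      then show ?thesis using fun_cong[OF b, of "j - r"] j by (simp add: comp_b_def)
    qed
  next
    case False
    \<comment> \<open>Points of \<open>Euclidean_space n\<close> vanish from index \<open>n\<close>
      on.\<close>
    then show ?thesis using assms(3,4) by (simp add: topspace_Euclidean_space)
  qed
qed

theorem proposition2:
  fixes n r N :: nat
    and \<X> :: "(nat \<Rightarrow> real) set" and U :: "'u set" and W :: "'w set"
    and f :: "(nat \<Rightarrow> real) \<Rightarrow> 'u \<Rightarrow> 'w \<Rightarrow> nat \<Rightarrow> real"
    and X :: "nat \<Rightarrow> (nat \<Rightarrow> real) set"
    and G :: "('g, 'z) monoid_scheme" and T :: "'g topology" and A :: "'g chart set"
    and \<phi> :: "'g \<Rightarrow> (nat \<Rightarrow> real) \<Rightarrow> nat \<Rightarrow> real"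
    and chi :: "'g \<Rightarrow> 'u \<Rightarrow> 'u" and \<psi> :: "'g \<Rightarrow> 'w \<Rightarrow> 'w"
    and \<sigma> :: "nat \<Rightarrow> nat" and c :: "nat \<Rightarrow> real" and C :: "(nat \<Rightarrow> real) set"
    and \<gamma> :: "(nat \<Rightarrow> real) \<Rightarrow> 'g"
    and \<rho> \<rho>inv :: "(nat \<Rightarrow> real) \<Rightarrow> nat \<Rightarrow> real"
    and J Jbar :: "nat \<Rightarrow> (nat \<Rightarrow> real) \<Rightarrow> real"
  assumes state_space: "openin (Euclidean_space n) \<X>"
    and nonempty: "U \<noteq> {}" "W \<noteq> {}"
    and dynamics: "\<And>x u w. x \<in> \<X> \<Longrightarrow> u \<in> U \<Longrightarrow> w \<in> W \<Longrightarrow> f x u w \<in> \<X>"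
    and target_tube: "\<And>k. k \<le> N \<Longrightarrow> X k \<subseteq> \<X>"
    and lie: "lie_group r G T A" and dim: "r \<le> n"
    and trans: "transformation_group G \<X> U W \<phi> chi \<psi>"
    and diffeo: "\<And>\<alpha>. \<alpha> \<in> carrier G \<Longrightarrow> diffeomorphism_on n \<X> (\<phi> \<alpha>)"
    and invariant: "invariant_problem G \<X> U W \<phi> chi \<psi> f X N"
    and splitting: "\<sigma> permutes {..<n}"
    and invertible: "\<And>x. x \<in> \<X> \<Longrightarrow> inj_on (\<lambda>\<alpha>. comp_a r \<sigma> (\<phi> \<alpha> x)) (carrier G)"
    and c_range: "\<exists>\<alpha>\<in>carrier G. \<exists>x\<in>\<X>. comp_a r \<sigma> (\<phi> \<alpha> x) = c"
    and C_def: "C = cross_section G \<X> \<phi> r \<sigma> c"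
    and frame: "moving_frame G \<X> \<phi> C \<gamma>"
    and \<rho>_def: "\<rho> = frame_invariants n r \<sigma> \<phi> \<gamma>"
    and \<rho>inv_def: "\<rho>inv = inv_into C \<rho>"
    and J_def: "J = value_fun f U W X N"
    and Jbar_def: "\<And>k. Jbar k = J k \<circ> \<rho>inv"
  shows "inj_on \<rho> C \<and> \<rho> ` \<X> \<subseteq> \<rho> ` C \<and>
    (\<forall>xb\<in>\<rho> ` C. Jbar N xb = stage_cost X N (\<rho>inv xb)) \<and>
    (\<forall>k<N. \<forall>xb\<in>\<rho> ` C.
       Jbar k xb =
         (MIN u\<in>U. MAX w\<in>W. stage_cost X k (\<rho>inv xb) + Jbar (Suc k) (\<rho> (f (\<rho>inv xb) u w)))) \<and>
    (\<forall>k\<le>N. effective_target \<X> f U W X N k = {x \<in> \<X>. Jbar k (\<rho> x) = 0})"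
proof -
  have G: "group G" using lie by (simp add: lie_group_def)
  have sub: "\<X> \<subseteq> topspace (Euclidean_space n)"
    using state_space by (rule openin_subset)
  have one: "\<phi> \<one>\<^bsub>G\<^esub> x = x" if "x \<in> \<X>" for x
    using trans that by (simp add: transformation_group_def)
  have C: "x \<in> C \<longleftrightarrow> x \<in> \<X> \<and> comp_a r \<sigma> x = c" for x
    using one by (auto simp: C_def cross_section_def)
  have \<rho>_C: "\<rho> x = comp_b n r \<sigma> x" if "x \<in> C" for x
    using moving_frame_on_section[OF G trans frame] that C
    by (simp add: \<rho>_def frame_invariants_def)
  have inj: "inj_on \<rho> C"
    by (rule inj_onI) (use C \<rho>_C sub in \<open>metis comp_a_comp_b_eqD[OF splitting dim] subsetD\<close>)
  have frame_pt: "\<gamma> x \<in> carrier G" "\<phi> (\<gamma> x) x \<in> C" if "x \<in> \<X>" for x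
    using frame that by (auto simp: moving_frame_def)
  \<comment> \<open>The frame point lies in \<open>C\<close>, where \<open>\<rho>\<close> merely
    reads off the second block; \<open>\<rho> x\<close> is by definition that block of the same
    point.\<close>
  have \<rho>_frame: "\<rho> (\<phi> (\<gamma> x) x) = \<rho> x" if "x \<in> \<X>" for x
    using \<rho>_C[OF frame_pt(2)[OF that]] by (simp add: \<rho>_def frame_invariants_def)
  have \<rho>inv: "\<rho>inv (\<rho> x) = \<phi> (\<gamma> x) x" if "x \<in> \<X>" for x
    using inv_into_f_f[OF inj frame_pt(2)[OF that]] \<rho>_frame[OF that] by (simp add: \<rho>inv_def)
  have Jbar: "Jbar k (\<rho> x) = J k x" if "x \<in> \<X>" "k \<le> N" for k x
    using value_fun_invariant[OF G trans invariant dynamics frame_pt(1)] that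
    by (simp add: Jbar_def J_def \<rho>inv)
  have \<rho>inv_mem: "\<rho>inv xb \<in> \<X>" if "xb \<in> \<rho> ` C" for xb
    using inv_into_into[OF that] C by (simp add: \<rho>inv_def)
  have "\<rho> ` \<X> \<subseteq> \<rho> ` C"
    using frame_pt(2) \<rho>_frame by (metis image_eqI image_subsetI)
  moreover have "Jbar N xb = stage_cost X N (\<rho>inv xb)" for xb
    by (simp add: Jbar_def J_def value_fun.simps)
  moreover have "Jbar k xb =
      (MIN u\<in>U. MAX w\<in>W. stage_cost X k (\<rho>inv xb) + Jbar (Suc k) (\<rho> (f (\<rho>inv xb) u w)))"
    if "k < N" "xb \<in> \<rho> ` C" for k xb
  proof -
    \<comment> \<open>The successor lies in \<open>\<X>\<close> but perhaps outside
      \<open>C\<close>. This is harmless because \<open>Jbar (Suc k) \<circ> \<rho>\<close> agrees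
      with \<open>J (Suc k)\<close> on all of \<open>\<X>\<close>.\<close>
    have "Jbar (Suc k) (\<rho> (f (\<rho>inv xb) u w)) = J (Suc k) (f (\<rho>inv xb) u w)"
      if "u \<in> U" "w \<in> W" for u w
      using Jbar dynamics \<rho>inv_mem \<open>k < N\<close> \<open>xb \<in> \<rho> ` C\<close> that by simp
    \<comment> \<open>What remains is the original recursion at \<open>\<rho>inv xb\<close>; only
      level \<open>k\<close> is unfolded.\<close>
    then show ?thesis
      using \<open>k < N\<close> by (simp add: Jbar_def[of k] J_def value_fun.simps[of _ _ _ _ _ k] cong: image_cong)
  qed
  moreover have "effective_target \<X> f U W X N k = {x \<in> \<X>. Jbar k (\<rho> x) = 0}" if "k \<le> N" for k
    using Jbar that by (auto simp: effective_target_def J_def)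
  ultimately show ?thesis using inj by blast
qed

end
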